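(* Let $f$ be a generator on $\mathbb{D}$ with $f(0)=0$, let $q=f'(0)$ with $\operatorname{Re} q>0$, and let $G_r=(\mathrm{Id}+rf)^{-1}$, $r>0$, be its nonlinear resolvents. For every $r>\frac{2}{\operatorname{Re} q}$, the resolvent $G_r$ extends holomorphically to the disk $D_{\rho(r)}$ of radius $$\rho(r)=\left(\sqrt{2r\operatorname{Re} q}-\sqrt{r\operatorname{Re} q-1}\right)^2>1,$$ and (the extension) satisfies $$|G_r(z)|\le \sqrt{\frac{2r\operatorname{Re} q}{r\operatorname{Re} q-1}}-1\qquad\text{for all } z\in D_{\rho(r)}.$$
   Context: $\mathbb{D}=\{z\in\mathbb{C}:|z|<1\}$ and $D_s=\{z\in\mathbb{C}:|z|<s\}$. A holomorphic function $f:\mathbb{D}\to\mathbb{C}$ is called a generator if for every $z\in\mathbb{D}$ the Cauchy problem $\frac{\partial u(t,z)}{\partial t}+f(u(t,z))=0$, $u(0,z)=z$, has a unique solution $u(t,z)\in\mathbb{D}$ defined for all $t\ge 0$. For a generator $f$ and $r>0$, it is known that $(\mathrm{Id}+rf)(\mathbb{D})\supset\mathbb{D}$ and that $G_r:=(\mathrm{Id}+rf)^{-1}$ is a well-defined holomorphic self-mapping of $\mathbb{D}$ (that is, $G_r(w)$ is the unique $z\in\mathbb{D}$ with $z+rf(z)=w$); it is called the nonlinear resolvent of $f$. *)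

theory Defs
  imports "HOL-Analysis.Analysis"
begin

abbreviation unit_disk :: "complex set" ("\<bbbD>")
  where "\<bbbD> \<equiv> ball 0 1"

text \<open>
  The derivative is taken within the half-line of nonnegative times, so it is one-sided at
  time 0. Values of a solution at negative times are irrelevant.
\<close>

definition cauchy_solution :: "(complex \<Rightarrow> complex) \<Rightarrow> complex \<Rightarrow> (real \<Rightarrow> complex) \<Rightarrow> bool"
  where "cauchy_solution f z u \<longleftrightarrow>
    u 0 = z \<and>
    (\<forall>t\<ge>0. u t \<in> \<bbbD> \<and> (u has_vector_derivative - f (u t)) (at t within {0..}))"

definition generator :: "(complex \<Rightarrow> complex) \<Rightarrow> bool"
  where "generator f \<longleftrightarrow>
    f holomorphic_on \<bbbD> \<and>
    (\<forall>z\<in>\<bbbD>. \<exists>u. cauchy_solution f z u \<and>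
      (\<forall>v. cauchy_solution f z v \<longrightarrow> (\<forall>t\<ge>0. v t = u t)))"

text \<open>
  For a generator and positive \<open>r\<close> the description below is satisfied by exactly one \<open>z\<close>
  whenever \<open>w\<close> lies in the unit disk. Outside the disk the value carries no meaning.
\<close>

definition nonlinear_resolvent :: "(complex \<Rightarrow> complex) \<Rightarrow> real \<Rightarrow> complex \<Rightarrow> complex"
  where "nonlinear_resolvent f r w = (THE z. z \<in> \<bbbD> \<and> z + of_real r * f z = w)"

end

theory Submission
  imports Defs "HOL-Complex_Analysis.Complex_Analysis"
begin

text \<open>
  Write \<open>f z = z * p z\<close>, so that \<open>p 0 = q\<close>. The heart of the matter is that \<open>Re p \<ge> 0\<close> on the unit
  disk. The maps \<open>z \<mapsto> u(t, z)\<close> of the flow are self-maps of the disk that fix 0. If they are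
  holomorphic, then the Schwarz lemma gives \<open>|u(t, z)| \<le> |z|\<close>, and differentiation of \<open>|u(t, z)|\<^sup>2\<close>
  at \<open>t = 0\<close> gives \<open>Re (p z) * |z|\<^sup>2 \<ge> 0\<close> (\<open>generator_fixing_0_accretive\<close>). The definition of a
  generator provides existence and uniqueness of the flow, but holomorphic dependence on the initial
  value has to be proved. This is done in \<open>solution_map_holomorphic\<close>, by a comparison of two
  orbits through the equation linearised along one of them.

  Harnack's inequality (\<open>harnack_lower_bound\<close>) then yields, with \<open>A = r * Re q > 2\<close> and
  \<open>F z = z + r * f z\<close>, the estimate \<open>|F z| \<ge> s * (1 + A * (1 - s) / (1 + s))\<close> on \<open>|z| = s\<close>. The
  right-hand side is largest at \<open>s0 = sqrt (2 * A / (A - 1)) - 1 < 1\<close>, where its value is \<open>\<rho>\<close>, and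
  it remains above 1 for \<open>s0 \<le> s < 1\<close> (\<open>radial_bound_at_critical_radius\<close>). As \<open>F\<close> has a single
  simple zero, Rouche's theorem shows that every \<open>w\<close> with \<open>|w| < \<rho>\<close> has exactly one preimage in
  the ball of radius \<open>s0\<close> (\<open>unique_preimage_in_ball\<close>). The inverse so obtained is holomorphic and
  bounded by \<open>s0\<close>. For \<open>|w| < 1\<close> there are no further preimages in \<open>s0 \<le> |z| < 1\<close>, so it extends
  the resolvent.
\<close>

section \<open>Differential equations with nearby initial values\<close>

text \<open>
  A bounded time interval, with one-sided derivatives at both ends, allows solutions to be cut off
  at the first time they leave a region.
\<close>

definition solves_until :: "('a::real_normed_vector \<Rightarrow> 'a) \<Rightarrow> real \<Rightarrow> (real \<Rightarrow> 'a) \<Rightarrow> bool"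
  where "solves_until f T u \<longleftrightarrow>
    (\<forall>t\<in>{0..T}. (u has_vector_derivative - f (u t)) (at t within {0..T}))"

lemma solves_until_continuous_on: "solves_until f T u \<Longrightarrow> continuous_on {0..T} u"
  unfolding solves_until_def continuous_on_eq_continuous_within
  using has_vector_derivative_continuous by blast

lemma solves_until_mono:
  assumes "solves_until f T u" "S \<le> T"
  shows "solves_until f S u"
  using assms unfolding solves_until_def
  by (auto intro: has_vector_derivative_within_subset[of _ _ _ "{0..T}"])

text \<open>
  Gronwall's inequality: \<open>exp (- 2 * L * t) * |v t - u t|\<^sup>2\<close> has nonpositive derivative. The
  solutions are confined to \<open>S\<close> only before time \<open>T\<close>, so that \<open>T\<close> may be a first exit time from \<open>S\<close>.
\<close>

lemma solutions_separate_at_most_exponentially: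
  fixes f :: "'a::real_inner \<Rightarrow> 'a"
  assumes "L-lipschitz_on S f" and T: "0 \<le> T"
    and u: "solves_until f T u" and v: "solves_until f T v"
    and S: "\<And>t. t \<in> {0..<T} \<Longrightarrow> u t \<in> S \<and> v t \<in> S"
  shows "norm (v T - u T) \<le> norm (v 0 - u 0) * exp (L * T)"
proof -
  define D where "D t = v t - u t" for t
  define N where "N t = (D t \<bullet> D t) * exp (- 2 * L * t)" for t
  have cu: "continuous_on {0..T} u" and cv: "continuous_on {0..T} v"
    using u v by (auto intro: solves_until_continuous_on)
  have "N T \<le> N 0"
  proof (rule DERIV_nonpos_imp_decreasing_open[OF T])
    show "continuous_on {0..T} N"
      unfolding N_def D_def by (intro continuous_intros cu cv)
    fix x assume x: "0 < x" "x < T"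
    then have at: "at x within {0..T} = at x" by (auto intro: at_within_interior)
    define E where "E = f (v x) - f (u x)"
    have "(u has_vector_derivative - f (u x)) (at x)" "(v has_vector_derivative - f (v x)) (at x)"
      using bspec[OF u[unfolded solves_until_def], of x]
        bspec[OF v[unfolded solves_until_def], of x] x at by auto
    then have "(D has_vector_derivative - E) (at x)"
      unfolding D_def E_def by (auto intro!: derivative_eq_intros)
    from bounded_bilinear.has_vector_derivative[OF bounded_bilinear_inner this this]
    have "((\<lambda>t. D t \<bullet> D t) has_real_derivative - 2 * (D x \<bullet> E)) (at x)"
      by (simp add: has_real_derivative_iff_has_vector_derivative inner_commute)
    then have "(N has_real_derivative
        (- 2 * (D x \<bullet> E) - 2 * L * (D x \<bullet> D x)) * exp (- 2 * L * x)) (at x)"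
      unfolding N_def by (auto intro!: derivative_eq_intros simp: algebra_simps)
    moreover have "- (D x \<bullet> E) \<le> norm (D x) * norm E"
      using norm_cauchy_schwarz[of "- D x" E] by simp
    moreover have "norm E \<le> L * norm (D x)"
      using lipschitz_onD[OF assms(1), of "v x" "u x"] S[of x] x
      by (auto simp: E_def D_def dist_norm)
    then have "norm (D x) * norm E \<le> L * (D x \<bullet> D x)"
      using mult_left_mono[of "norm E" "L * norm (D x)" "norm (D x)"]
      by (simp add: power2_norm_eq_inner[symmetric] power2_eq_square algebra_simps)
    ultimately show "\<exists>y. (N has_real_derivative y) (at x) \<and> y \<le> 0"
      by (intro exI[of _ "(- 2 * (D x \<bullet> E) - 2 * L * (D x \<bullet> D x)) * exp (- 2 * L * x)"])
        (auto simp: mult_le_0_iff)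
  qed
  then have "(norm (D T))\<^sup>2 * exp (- 2 * L * T) \<le> (norm (D 0))\<^sup>2"
    by (simp add: N_def power2_norm_eq_inner)
  then have "(norm (D T))\<^sup>2 \<le> (norm (D 0) * exp (L * T))\<^sup>2"
    by (simp add: exp_minus power_mult_distrib field_simps exp_double[symmetric]
        flip: power2_eq_square exp_of_nat_mult)
  then show ?thesis
    by (auto simp: D_def intro: power2_le_imp_le)
qed

text \<open>
  At the first time \<open>s\<close> at which \<open>v\<close> reaches norm \<open>R'\<close>, Gronwall's inequality is still valid and
  keeps \<open>v s\<close> closer than \<open>R' - R\<close> to \<open>u s\<close>, a contradiction.
\<close>

lemma nearby_solution_stays_in_ball:
  fixes f :: "'a::real_inner \<Rightarrow> 'a"
  assumes L: "L-lipschitz_on (cball 0 R') f"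
    and u: "solves_until f T u" and v: "solves_until f T v"
    and uR: "\<And>t. t \<in> {0..T} \<Longrightarrow> norm (u t) \<le> R"
    and close: "norm (v 0 - u 0) * exp (L * T) < R' - R"
    and t: "t \<in> {0..T}"
  shows "norm (v t) < R'"
proof (rule ccontr)
  assume far: "\<not> norm (v t) < R'"
  define A where "A = {0..T} \<inter> (\<lambda>t. norm (v t)) -` {R'..}"
  have L0: "0 \<le> L" using L by (rule lipschitz_on_nonneg)
  have "R < R'" using close
    by (smt (verit) exp_gt_zero norm_ge_zero zero_le_mult_iff)
  have "closed A"
    unfolding A_def
    by (intro continuous_closed_preimage continuous_intros solves_until_continuous_on[OF v])
  moreover have "bounded A"
    by (rule bounded_subset[of "{0..T}"]) (auto simp: A_def)
  ultimately have "compact A"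
    by (simp add: compact_eq_bounded_closed)
  moreover have "t \<in> A" using t far by (auto simp: A_def)
  ultimately obtain s where s: "s \<in> A" "\<And>t. t \<in> A \<Longrightarrow> s \<le> t"
    using compact_attains_inf[of A] by auto
  have sT: "0 \<le> s" "s \<le> T" using s by (auto simp: A_def)
  have "norm (v s - u s) \<le> norm (v 0 - u 0) * exp (L * s)"
  proof (rule solutions_separate_at_most_exponentially[OF L])
    fix x assume x: "x \<in> {0..<s}"
    then have "x \<notin> A" using s by fastforce
    moreover have "norm (u x) \<le> R'" using uR[of x] x sT \<open>R < R'\<close> by auto
    ultimately show "u x \<in> cball 0 R' \<and> v x \<in> cball 0 R'"
      using x sT by (auto simp: A_def)
  qed (use u v sT solves_until_mono in auto)
  also have "\<dots> \<le> norm (v 0 - u 0) * exp (L * T)"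
    using L0 sT by (intro mult_left_mono) (auto intro: mult_left_mono)
  finally have "norm (v s) < R'"
    using close uR[of s] sT norm_triangle_sub[of "v s" "u s"] by auto
  then show False using s by (auto simp: A_def)
qed

section \<open>The flow of a holomorphic vector field is holomorphic\<close>

lemma holomorphic_quadratic_remainder:
  assumes f: "f holomorphic_on A" "open A" and K: "compact K" "convex K" "K \<subseteq> A"
  obtains B where "B \<ge> 0"
    "\<And>a b. a \<in> K \<Longrightarrow> b \<in> K \<Longrightarrow> norm (f b - f a - deriv f a * (b - a)) \<le> B * (norm (b - a))\<^sup>2"
proof -
  have h: "(deriv ^^ i) f holomorphic_on A" for i
    using f by (rule holomorphic_higher_deriv)
  have "compact ((deriv ^^ 2) f ` K)"
    using K h[of 2] by (intro compact_continuous_image holomorphic_on_imp_continuous_on)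
       (auto intro: holomorphic_on_subset)
  then obtain B where B: "B > 0" "\<And>x. x \<in> K \<Longrightarrow> norm ((deriv ^^ 2) f x) \<le> B"
    by (auto dest!: compact_imp_bounded simp: bounded_pos)
  have "norm (f b - f a - deriv f a * (b - a)) \<le> B * (norm (b - a))\<^sup>2" if "a \<in> K" "b \<in> K" for a b
  proof -
    have "norm ((deriv ^^ 0) f b - (\<Sum>i\<le>1. (deriv ^^ i) f a * (b - a) ^ i / fact i))
       \<le> B * norm (b - a) ^ Suc 1 / fact 1"
    proof (rule complex_Taylor[OF \<open>convex K\<close> _ _ that])
      fix i x assume "x \<in> K"
      then have "x \<in> A" using K by auto
      then show "((deriv ^^ i) f has_field_derivative (deriv ^^ Suc i) f x) (at x within K)"
        using holomorphic_derivI[OF h[of i] f(2)] by auto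
    qed (use B in \<open>auto simp: numeral_2_eq_2\<close>)
    then show ?thesis by (simp add: power2_eq_square algebra_simps)
  qed
  with B(1) show ?thesis by (intro that[of B]) auto
qed

lemma holomorphic_lipschitz_on_compact:
  assumes f: "f holomorphic_on A" "open A" and K: "compact K" "convex K" "K \<subseteq> A"
  obtains L where "L-lipschitz_on K f"
proof -
  have "compact (deriv f ` K)"
    using K f by (intro compact_continuous_image holomorphic_on_imp_continuous_on)
       (auto intro: holomorphic_on_subset holomorphic_deriv)
  then obtain B where B: "B > 0" "\<And>x. x \<in> K \<Longrightarrow> norm (deriv f x) \<le> B"
    by (auto dest!: compact_imp_bounded simp: bounded_pos)
  have "B-lipschitz_on K f"
  proof (rule lipschitz_onI)
    fix x y assume xy: "x \<in> K" "y \<in> K"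
    have "norm (f x - f y) \<le> B * norm (x - y)"
      by (rule field_differentiable_bound[OF \<open>convex K\<close> _ B(2) xy, where f = f])
         (use K f in \<open>auto intro: holomorphic_derivI\<close>)
    then show "dist (f x) (f y) \<le> B * dist x y" by (simp add: dist_norm)
  qed (use B in auto)
  then show ?thesis by (rule that)
qed

lemma has_field_derivativeI_quadratic:
  fixes g :: "'a::real_normed_field \<Rightarrow> 'a"
  assumes d: "d > 0" and q: "\<And>w. norm (w - z) < d \<Longrightarrow> norm (g w - g z - D * (w - z)) \<le> C * (norm (w - z))\<^sup>2"
  shows "(g has_field_derivative D) (at z)"
proof -
  have "((\<lambda>w. (g w - g z) / (w - z) - D) \<longlongrightarrow> 0) (at z)"
  proof (rule Lim_null_comparison)
    show "((\<lambda>w. C * norm (w - z)) \<longlongrightarrow> 0) (at z)"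
      by (auto intro!: tendsto_eq_intros)
    show "\<forall>\<^sub>F w in at z. norm ((g w - g z) / (w - z) - D) \<le> C * norm (w - z)"
      unfolding eventually_at
    proof (intro exI[of _ d] conjI ballI impI d)
      fix w assume w: "w \<noteq> z \<and> dist w z < d"
      have "(g w - g z) / (w - z) - D = (g w - g z - D * (w - z)) / (w - z)"
        using w by (simp add: field_simps)
      then show "norm ((g w - g z) / (w - z) - D) \<le> C * norm (w - z)"
        using q[of w] w by (auto simp: dist_norm norm_divide field_simps power2_eq_square)
    qed
  qed
  then show ?thesis
    by (simp add: has_field_derivative_iff LIM_zero_iff)
qed

text \<open>
  The derivative of the time-\<open>T\<close> map at \<open>z\<close> must solve the equation \<open>Y' = - f'(u z t) * Y\<close>,
  \<open>Y 0 = 1\<close>, linearised along the orbit of \<open>z\<close>; its solution is \<open>Y = 1 / e\<close>, where \<open>e\<close> is the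
  exponential of the integral of \<open>f'(u z t)\<close>. For the difference \<open>D\<close> of two orbits, the product
  \<open>D * e\<close> therefore changes only through the second-order Taylor remainder of \<open>f\<close>, that is by
  \<open>O(|D|\<^sup>2)\<close>, and Gronwall's inequality turns this into \<open>O(|w - z|\<^sup>2)\<close>.
\<close>

lemma solution_map_holomorphic:
  assumes f: "f holomorphic_on \<bbbD>" and T: "0 \<le> T"
    and u: "\<And>z. z \<in> \<bbbD> \<Longrightarrow> solves_until f T (u z)"
    and u0: "\<And>z. z \<in> \<bbbD> \<Longrightarrow> u z 0 = z"
    and uD: "\<And>z t. z \<in> \<bbbD> \<Longrightarrow> t \<in> {0..T} \<Longrightarrow> u z t \<in> \<bbbD>"
  shows "(\<lambda>z. u z T) holomorphic_on \<bbbD>"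
proof (unfold holomorphic_on_open[OF open_ball], intro ballI)
  fix z assume z: "z \<in> \<bbbD>"
  have cu: "continuous_on {0..T} (u z)" by (rule solves_until_continuous_on[OF u[OF z]])
  have "continuous_on {0..T} (\<lambda>t. norm (u z t))" by (intro continuous_intros cu)
  then obtain m where m: "m \<in> {0..T}" "\<And>t. t \<in> {0..T} \<Longrightarrow> norm (u z t) \<le> norm (u z m)"
    using continuous_attains_sup[of "{0..T}" "\<lambda>t. norm (u z t)"] T
    by (metis atLeastAtMost_iff compact_Icc empty_iff order_refl)
  \<comment> \<open>The orbit of \<open>z\<close> is compact; \<open>R'\<close> leaves room for the orbits of nearby points.\<close>
  define R where "R = norm (u z m)"
  define R' where "R' = (R + 1) / 2"
  have R: "\<And>t. t \<in> {0..T} \<Longrightarrow> norm (u z t) \<le> R" "R < R'" "R' < 1"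
    using m uD[OF z m(1)] by (auto simp: R_def R'_def)
  have R'D: "cball 0 R' \<subseteq> \<bbbD>" using R by auto
  obtain L where L: "L-lipschitz_on (cball 0 R') f"
    using holomorphic_lipschitz_on_compact[OF f open_ball compact_cball convex_cball R'D] by blast
  obtain B where B: "B \<ge> 0" "\<And>a b. a \<in> cball 0 R' \<Longrightarrow> b \<in> cball 0 R' \<Longrightarrow>
      norm (f b - f a - deriv f a * (b - a)) \<le> B * (norm (b - a))\<^sup>2"
    using holomorphic_quadratic_remainder[OF f open_ball compact_cball convex_cball R'D] by blast
  define \<psi> where "\<psi> t = integral {0..t} (\<lambda>s. deriv f (u z s))" for t
  have "continuous_on {0..T} (\<lambda>s. deriv f (u z s))"
    using uD[OF z]
    by (intro continuous_on_compose2[OF _ cu, of \<bbbD>] holomorphic_on_imp_continuous_on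
          holomorphic_deriv f open_ball) auto
  then have \<psi>: "(\<psi> has_vector_derivative deriv f (u z t)) (at t within {0..T})"
    if "t \<in> {0..T}" for t
    unfolding \<psi>_def using that by (rule integral_has_vector_derivative)
  define e where "e t = exp (\<psi> t)" for t
  have e: "(e has_vector_derivative deriv f (u z t) * e t) (at t within {0..T})"
    if "t \<in> {0..T}" for t
    unfolding e_def using field_vector_diff_chain_within[OF \<psi>[OF that] DERIV_exp[THEN has_field_derivative_at_within]]
    by (simp add: o_def)
  have "compact (e ` {0..T})"
    using e by (intro compact_continuous_image)
      (auto simp: continuous_on_eq_continuous_within intro: has_vector_derivative_continuous[OF e])
  then obtain E where E: "E > 0" "\<And>t. t \<in> {0..T} \<Longrightarrow> norm (e t) \<le> E"
    by (auto dest!: compact_imp_bounded simp: bounded_pos)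
  define K where "K = exp (L * T)"
  have "0 \<le> L" using L by (rule lipschitz_on_nonneg)
  then have K1: "1 \<le> K" using T by (simp add: K_def)
  define d where "d = (R' - R) / K"
  define C where "C = E * B * K\<^sup>2 * T / norm (e T)"
  have "((\<lambda>z. u z T) has_field_derivative inverse (e T)) (at z)"
  proof (rule has_field_derivativeI_quadratic)
    show "d > 0" using R K1 by (auto simp: d_def)
    fix w assume "norm (w - z) < d"
    then have close: "norm (w - z) * K < R' - R"
      using K1 by (simp add: d_def field_simps)
    have "norm (w - z) * 1 \<le> norm (w - z) * K" using K1 by (intro mult_left_mono) auto
    moreover have "norm z \<le> R" using R(1)[of 0] T u0[OF z] by auto
    ultimately have w: "w \<in> \<bbbD>"
      using close R norm_triangle_sub[of w z] by auto
    note stays = nearby_solution_stays_in_ball[OF L u[OF z] u[OF w] R(1), unfolded u0[OF z] u0[OF w],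
        folded K_def, OF _ close]
    define D where "D t = u w t - u z t" for t
    have sep: "norm (D t) \<le> norm (w - z) * K" if t: "t \<in> {0..T}" for t
    proof -
      have "norm (u w t - u z t) \<le> norm (u w 0 - u z 0) * exp (L * t)"
      proof (rule solutions_separate_at_most_exponentially[OF L])
        fix s assume "s \<in> {0..<t}"
        then have "s \<in> {0..T}" using t by auto
        then show "u z s \<in> cball 0 R' \<and> u w s \<in> cball 0 R'"
          using stays[of s] R(1)[of s] R(2) by auto
      qed (use t u[OF z] u[OF w] solves_until_mono in auto)
      also have "\<dots> \<le> norm (w - z) * K"
        using t \<open>0 \<le> L\<close> by (auto simp: u0[OF z] u0[OF w] K_def intro!: mult_left_mono)
      finally show ?thesis by (simp add: D_def)
    qed
    define W where "W t = D t * e t" for t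
    define W' where "W' t = - (f (u w t) - f (u z t) - deriv f (u z t) * D t) * e t" for t
    have W': "(W has_vector_derivative W' t) (at t within {0..T})" if t: "t \<in> {0..T}" for t
    proof -
      have "(D has_vector_derivative - f (u w t) - - f (u z t)) (at t within {0..T})"
        unfolding D_def using u[OF z] u[OF w] t unfolding solves_until_def
        by (intro has_vector_derivative_diff) auto
      from has_vector_derivative_mult[OF this e[OF t]] show ?thesis
        unfolding W_def W'_def by (simp add: algebra_simps)
    qed
    have W'le: "norm (W' t) \<le> E * B * K\<^sup>2 * (norm (w - z))\<^sup>2" if t: "t \<in> {0..T}" for t
    proof -
      have "norm (f (u w t) - f (u z t) - deriv f (u z t) * D t) \<le> B * (norm (D t))\<^sup>2"
        using B(2)[of "u z t" "u w t"] stays[OF _ t] R(1)[OF t] R(1,2) by (auto simp: D_def)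
      also have "\<dots> \<le> B * (norm (w - z) * K)\<^sup>2"
        using B(1) sep[OF t] by (intro mult_left_mono power_mono) auto
      finally have "norm (W' t) \<le> B * (norm (w - z) * K)\<^sup>2 * E"
        unfolding W'_def norm_mult norm_minus_cancel using E t
        by (intro mult_mono) (auto intro!: mult_nonneg_nonneg B(1))
      then show ?thesis by (simp add: power_mult_distrib mult_ac)
    qed
    have "norm (W T - W 0) \<le> E * B * K\<^sup>2 * (norm (w - z))\<^sup>2 * norm (T - 0)"
    proof (rule differentiable_bound[of "{0..T}"])
      fix t assume t: "t \<in> {0..T}"
      show "(W has_derivative (\<lambda>h. h *\<^sub>R W' t)) (at t within {0..T})"
        using W'[OF t] by (simp add: has_vector_derivative_def)
      show "onorm (\<lambda>h. h *\<^sub>R W' t) \<le> E * B * K\<^sup>2 * (norm (w - z))\<^sup>2"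
        using W'le[OF t] by (intro onorm_le) (simp add: mult.commute[of "\<bar>_\<bar>"] mult_right_mono)
    qed (use T in auto)
    moreover have "W 0 = w - z"
      by (simp add: W_def D_def e_def \<psi>_def u0[OF z] u0[OF w])
    ultimately have "norm (D T * e T - (w - z)) \<le> E * B * K\<^sup>2 * (norm (w - z))\<^sup>2 * T"
      using T by (simp add: W_def)
    moreover have "D T - inverse (e T) * (w - z) = (D T * e T - (w - z)) / e T"
      by (simp add: e_def field_simps)
    ultimately show "norm (u w T - u z T - inverse (e T) * (w - z)) \<le> C * (norm (w - z))\<^sup>2"
      by (simp add: D_def[symmetric] norm_divide C_def divide_right_mono mult_ac)
  qed
  then show "\<exists>f'. ((\<lambda>z. u z T) has_field_derivative f') (at z)" by blast
qed

section \<open>The sign condition for generators that vanish at the origin\<close>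

lemma cauchy_solution_imp_solves_until:
  assumes "cauchy_solution f z u"
  shows "solves_until f T u"
  using assms unfolding solves_until_def cauchy_solution_def
  by (auto intro: has_vector_derivative_within_subset[of _ _ _ "{0..}"])

text \<open>
  The time-\<open>t\<close> map is a holomorphic self-map of the disk, and it fixes 0 because the constant
  solution is the only one that starts there. The Schwarz lemma applies.
\<close>

lemma generator_flow_contracts:
  assumes gen: "generator f" and f0: "f 0 = 0"
    and u: "cauchy_solution f z u" and z: "z \<in> \<bbbD>" and t: "0 \<le> t"
  shows "norm (u t) \<le> norm z"
proof -
  obtain \<phi> where \<phi>: "\<And>z. z \<in> \<bbbD> \<Longrightarrow> cauchy_solution f z (\<phi> z)"
    and uniq: "\<And>z v s. z \<in> \<bbbD> \<Longrightarrow> cauchy_solution f z v \<Longrightarrow> s \<ge> 0 \<Longrightarrow> v s = \<phi> z s"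
    using gen unfolding generator_def by metis
  have "cauchy_solution f 0 (\<lambda>_. 0)"
    by (simp add: cauchy_solution_def f0)
  then have fix0: "\<phi> 0 t = 0"
    using uniq[of 0 "\<lambda>_. 0" t] t by simp
  have D: "\<phi> w s \<in> \<bbbD>" if "w \<in> \<bbbD>" "s \<ge> 0" for w s
    using \<phi>[OF that(1)] that(2) unfolding cauchy_solution_def by blast
  have "(\<lambda>z. \<phi> z t) holomorphic_on \<bbbD>"
  proof (rule solution_map_holomorphic[OF _ t])
    show "f holomorphic_on \<bbbD>" using gen by (simp add: generator_def)
  qed (use \<phi> D in \<open>auto simp: cauchy_solution_imp_solves_until cauchy_solution_def[of f _ "\<phi> _"]\<close>)
  then have "norm (\<phi> z t) \<le> norm z"
    by (rule Schwarz_Lemma(1)) (use fix0 D t z in auto)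
  then show ?thesis using uniq[OF z u t] by simp
qed

text \<open>
  Since \<open>-2 * (z \<bullet> f z)\<close> is the initial derivative of \<open>|u t|\<^sup>2\<close>, a negative inner product would
  make the norm grow at first. In terms of \<open>p z = f z / z\<close> the conclusion reads \<open>Re (p z) \<ge> 0\<close>,
  which is the Berkson--Porta condition.
\<close>

lemma generator_fixing_0_accretive:
  assumes gen: "generator f" and f0: "f 0 = 0" and z: "z \<in> \<bbbD>"
  shows "0 \<le> z \<bullet> f z"
proof (rule ccontr)
  assume neg: "\<not> 0 \<le> z \<bullet> f z"
  obtain u where u: "cauchy_solution f z u"
    using gen z unfolding generator_def by blast
  then have u0: "u 0 = z" and du: "(u has_vector_derivative - f z) (at 0 within {0..})"
    unfolding cauchy_solution_def by auto
  from bounded_bilinear.has_vector_derivative[OF bounded_bilinear_inner du du]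
  have "((\<lambda>t. u t \<bullet> u t) has_real_derivative - 2 * (z \<bullet> f z)) (at 0 within {0..})"
    by (simp add: has_real_derivative_iff_has_vector_derivative inner_commute u0)
  from has_real_derivative_pos_inc_right[OF this] neg
  obtain d where d: "d > 0" "\<And>h. h > 0 \<Longrightarrow> h < d \<Longrightarrow> u 0 \<bullet> u 0 < u h \<bullet> u h"
    by auto
  have "z \<bullet> z < u (d / 2) \<bullet> u (d / 2)" using d(2)[of "d / 2"] d(1) u0 by simp
  then have "norm z < norm (u (d / 2))"
    by (simp add: norm_eq_sqrt_inner)
  with generator_flow_contracts[OF gen f0 u z, of "d / 2"] d(1) show False by simp
qed

section \<open>Harnack's inequality\<close>

lemma div_by_id_holomorphic:
  assumes f: "f holomorphic_on A" "open A" and f0: "f 0 = 0"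
  obtains p where "p holomorphic_on A" "\<And>z. f z = z * p z" "p 0 = deriv f 0"
proof
  let ?p = "\<lambda>z. if z = 0 then deriv f 0 else (f z - f 0) / (z - 0)"
  show "?p holomorphic_on A" by (rule pole_lemma_open[OF f])
qed (use f0 in auto)

text \<open>
  The map \<open>(a - p) / (cnj a + p)\<close> with \<open>a = p 0\<close> sends the right half-plane to the unit disk and
  \<open>a\<close> to 0, so the Schwarz lemma bounds it by \<open>|z|\<close>. The values \<open>p z\<close> allowed by that bound fill a
  disk whose leftmost point has real part \<open>Re a * (1 - |z|) / (1 + |z|)\<close>.
\<close>

lemma harnack_lower_bound_strict:
  assumes p: "p holomorphic_on \<bbbD>" and pos: "\<And>z. z \<in> \<bbbD> \<Longrightarrow> 0 < Re (p z)" and z: "z \<in> \<bbbD>"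
  shows "Re (p 0) * (1 - norm z) / (1 + norm z) \<le> Re (p z)"
proof -
  define a where "a = p 0"
  have a: "0 < Re a" using pos[of 0] by (simp add: a_def)
  have diff: "(norm (cnj a + w))\<^sup>2 - (norm (a - w))\<^sup>2 = 4 * Re a * Re w" for w
    unfolding cmod_power2 by (simp add: power2_eq_square algebra_simps)
  have nz: "cnj a + p w \<noteq> 0" if "w \<in> \<bbbD>" for w
    using pos[OF that] a by (auto simp: complex_eq_iff)
  define \<omega> where "\<omega> w = (a - p w) / (cnj a + p w)" for w
  have "norm (\<omega> z) \<le> norm z"
  proof (rule Schwarz_Lemma(1))
    show "\<omega> holomorphic_on \<bbbD>"
      unfolding \<omega>_def by (intro holomorphic_intros p) (use nz in auto)
    fix w :: complex assume "norm w < 1"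
    then have w: "w \<in> \<bbbD>" by simp
    have "(norm (a - p w))\<^sup>2 < (norm (cnj a + p w))\<^sup>2"
      using diff[of "p w"] a pos[OF w] by (smt (verit) mult_pos_pos)
    then have "norm (a - p w) < norm (cnj a + p w)" by (rule power2_less_imp_less) simp
    then show "norm (\<omega> w) < 1" using nz[OF w] by (simp add: \<omega>_def norm_divide)
  qed (use z in \<open>auto simp: \<omega>_def a_def\<close>)
  then have "norm (a - p z) \<le> norm z * norm (cnj a + p z)"
    using nz[OF z] by (simp add: \<omega>_def norm_divide field_simps)
  define s where "s = norm z"
  have s: "0 \<le> s" "s < 1" using z by (auto simp: s_def)
  have "(norm (a - p z))\<^sup>2 \<le> (s * norm (cnj a + p z))\<^sup>2"
    using \<open>norm (a - p z) \<le> _\<close> unfolding s_def by (rule power_mono) simp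
  then have "(Re a - Re (p z))\<^sup>2 + (Im a - Im (p z))\<^sup>2
      \<le> s\<^sup>2 * ((Re a + Re (p z))\<^sup>2 + (Im a - Im (p z))\<^sup>2)"
    unfolding power_mult_distrib cmod_power2 by (simp add: power2_commute)
  moreover have "s\<^sup>2 * (Im a - Im (p z))\<^sup>2 \<le> 1 * (Im a - Im (p z))\<^sup>2"
    using s by (intro mult_right_mono) (auto simp: power_le_one)
  ultimately have "(Re a - Re (p z))\<^sup>2 \<le> (s * (Re a + Re (p z)))\<^sup>2"
    unfolding power_mult_distrib[of s "Re a + Re (p z)"] unfolding distrib_left by linarith
  then have "Re a - Re (p z) \<le> s * (Re a + Re (p z))"
    by (rule power2_le_imp_le) (use a pos[OF z] s in \<open>intro mult_nonneg_nonneg; simp\<close>)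
  then have "Re a * (1 - s) \<le> Re (p z) * (1 + s)" by (simp add: algebra_simps)
  then show ?thesis using s by (simp add: a_def[symmetric] s_def[symmetric] pos_divide_le_eq)
qed

text \<open>
  The strict version for \<open>p + \<epsilon>\<close>, with \<open>\<epsilon>\<close> tending to 0.
\<close>

lemma harnack_lower_bound:
  assumes p: "p holomorphic_on \<bbbD>" and pos: "\<And>z. z \<in> \<bbbD> \<Longrightarrow> 0 \<le> Re (p z)" and z: "z \<in> \<bbbD>"
  shows "Re (p 0) * (1 - norm z) / (1 + norm z) \<le> Re (p z)"
proof (rule tendsto_le[where F = "at_right (0::real)"])
  show "((\<lambda>\<epsilon>. Re (p z) + \<epsilon>) \<longlongrightarrow> Re (p z)) (at_right 0)"
    "((\<lambda>\<epsilon>. (Re (p 0) + \<epsilon>) * (1 - norm z) / (1 + norm z))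
      \<longlongrightarrow> Re (p 0) * (1 - norm z) / (1 + norm z)) (at_right 0)"
    by (auto intro!: tendsto_eq_intros simp: add_nonneg_eq_0_iff)
  show "\<forall>\<^sub>F \<epsilon> in at_right 0. (Re (p 0) + \<epsilon>) * (1 - norm z) / (1 + norm z) \<le> Re (p z) + \<epsilon>"
  proof (rule eventually_at_right_less[THEN eventually_mono])
    fix \<epsilon> :: real assume "0 < \<epsilon>"
    then show "(Re (p 0) + \<epsilon>) * (1 - norm z) / (1 + norm z) \<le> Re (p z) + \<epsilon>"
      using harnack_lower_bound_strict[of "\<lambda>z. p z + of_real \<epsilon>" z] pos z p
      by (force intro: holomorphic_intros add_nonneg_pos)
  qed
qed simp

section \<open>Inverting a holomorphic map on a disk\<close>

text \<open>
  By Rouche's theorem, \<open>F - w\<close> and \<open>F\<close> have equally many zeros in the ball of radius \<open>s\<close>, counted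
  with multiplicity, and \<open>F\<close> has just the simple one at 0.
\<close>

lemma unique_preimage_in_ball:
  assumes F: "F holomorphic_on ball 0 R" and s: "0 < s" "s < R"
    and F0: "\<And>z. z \<in> ball 0 R \<Longrightarrow> F z = 0 \<longleftrightarrow> z = 0" and dF: "deriv F 0 \<noteq> 0"
    and w: "\<And>z. norm z = s \<Longrightarrow> norm w < norm (F z)"
  shows "\<exists>!z. z \<in> ball 0 s \<and> F z = w"
proof -
  \<comment> \<open>On a ball with compact closure in the domain, \<open>F - w\<close> has only finitely many zeros.\<close>
  define m where "m = (s + R) / 2"
  have m: "s < m" "m < R" using s by (auto simp: m_def)
  define G where "G z = F z + - w" for z
  define Z where "Z = {z \<in> ball 0 m. F z + - w = 0}"
  have holF: "F holomorphic_on ball 0 m" using F m by (auto intro: holomorphic_on_subset)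
  have holG: "G holomorphic_on ball 0 R" unfolding G_def by (intro holomorphic_intros F)
  have F00: "F 0 = 0" using F0[of 0] s by simp
  have Fs: "F (of_real s) \<noteq> 0" using F0[of "of_real s"] s by simp
  have "\<not> G constant_on ball 0 R"
  proof
    assume "G constant_on ball 0 R"
    then have "G (of_real s) = G 0" using s unfolding constant_on_def by force
    with Fs F00 show False by (simp add: G_def)
  qed
  then have "finite {z \<in> cball 0 m. G z = 0}"
    using m by (intro holomorphic_compact_finite_zeros[OF holG]) auto
  then have finZ: "finite Z" by (rule rev_finite_subset) (auto simp: Z_def G_def)
  have Z0: "{p \<in> ball 0 m. F p = 0} = {0}" using F0 F00 m s by auto
  have "(\<Sum>p\<in>Z. winding_number (circlepath 0 s) p * zorder (\<lambda>p. F p + - w) p) =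
      (\<Sum>p\<in>{p \<in> ball 0 m. F p = 0}. winding_number (circlepath 0 s) p * zorder F p)"
    unfolding Z_def
  proof (rule Rouche_theorem)
    show "\<forall>z. z \<notin> ball 0 m \<longrightarrow> winding_number (circlepath 0 s) z = 0"
      using m s by (auto intro!: winding_number_zero_outside[of _ "cball 0 s"])
  qed (use finZ Z0 holF s m w in \<open>auto simp: Z_def\<close>)
  also have "\<dots> = 1"
  proof -
    have "zorder F 0 = 1"
      by (rule zorder_zero_eqI[OF F open_ball]) (use s dF F00 in auto)
    moreover have "winding_number (circlepath 0 s) 0 = 1"
      using s by (intro winding_number_circlepath) auto
    ultimately show ?thesis unfolding Z0 by simp
  qed
  also have "(\<Sum>p\<in>Z. winding_number (circlepath 0 s) p * zorder (\<lambda>p. F p + - w) p) =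
      (\<Sum>p\<in>Z \<inter> ball 0 s. winding_number (circlepath 0 s) p * zorder (\<lambda>p. F p + - w) p)"
  proof (rule sum.mono_neutral_right[OF finZ Int_lower1], intro ballI)
    fix p assume p: "p \<in> Z - Z \<inter> ball 0 s"
    then have "norm p \<noteq> s" using w[of p] by (auto simp: Z_def)
    with p have "p \<notin> cball 0 s" by auto
    then show "winding_number (circlepath 0 s) p * zorder (\<lambda>p. F p + - w) p = 0"
      using s by (simp add: winding_number_zero_outside[of _ "cball 0 s"])
  qed
  also have "\<dots> = (\<Sum>p\<in>Z \<inter> ball 0 s. of_int (zorder (\<lambda>p. F p + - w) p))"
    by (intro sum.cong) (auto simp: winding_number_circlepath)
  finally have "of_int (\<Sum>p\<in>Z \<inter> ball 0 s. zorder G p) = (1::complex)"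
    by (simp add: G_def[abs_def])
  then have sum1: "(\<Sum>p\<in>Z \<inter> ball 0 s. zorder G p) = 1" by (simp only: of_int_eq_1_iff)
  have "zorder G p \<ge> 1" if "p \<in> Z \<inter> ball 0 s" for p
  proof -
    have "\<exists>w\<in>ball 0 R. G w \<noteq> 0"
      using \<open>\<not> G constant_on ball 0 R\<close> unfolding constant_on_def by blast
    from zorder_exist_zero[OF holG _ _ _ this, of p] that m s show ?thesis
      by (auto simp: Z_def G_def)
  qed
  then have "(\<Sum>p\<in>Z \<inter> ball 0 s. 1) \<le> (\<Sum>p\<in>Z \<inter> ball 0 s. zorder G p)" by (rule sum_mono)
  then have "card (Z \<inter> ball 0 s) \<le> 1" using sum1 by simp
  moreover have "Z \<inter> ball 0 s \<noteq> {}"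
  proof
    assume "Z \<inter> ball 0 s = {}"
    with sum1 show False by simp
  qed
  ultimately have "card (Z \<inter> ball 0 s) = 1"
    using finZ by (metis card_gt_0_iff finite_Int le_less less_one not_less_iff_gr_or_eq)
  then obtain z where "Z \<inter> ball 0 s = {z}" by (auto simp: card_1_singleton_iff)
  moreover have "Z \<inter> ball 0 s = {z. z \<in> ball 0 s \<and> F z = w}" using m by (auto simp: Z_def)
  ultimately have eq: "{z. z \<in> ball 0 s \<and> F z = w} = {z}" by simp
  show ?thesis
  proof (rule ex1I)
    show "z \<in> ball 0 s \<and> F z = w" using eq by (blast dest: equalityD2)
  next
    fix z' assume "z' \<in> ball 0 s \<and> F z' = w"
    then have "z' \<in> {z. z \<in> ball 0 s \<and> F z = w}" by (rule CollectI)
    then show "z' = z" unfolding eq by (rule singletonD)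
  qed
qed

text \<open>
  Injectivity of \<open>F\<close> may fail on the ball of radius \<open>s\<close>, but it holds on the part of that ball which
  \<open>F\<close> maps into the ball of radius \<open>\<rho>\<close>; this part is open and is mapped onto the latter.
\<close>

lemma holomorphic_inverse_on_ball:
  assumes F: "F holomorphic_on ball 0 s"
    and ex1: "\<And>w. w \<in> ball 0 \<rho> \<Longrightarrow> \<exists>!z. z \<in> ball 0 s \<and> F z = w"
  obtains H where "H holomorphic_on ball 0 \<rho>"
    "\<And>w. w \<in> ball 0 \<rho> \<Longrightarrow> H w \<in> ball 0 s \<and> F (H w) = w"
proof -
  define U where "U = ball 0 s \<inter> F -` ball 0 \<rho>"
  have "open U"
    unfolding U_def
    using holomorphic_on_imp_continuous_on[OF F] open_ball open_ball by (rule continuous_open_preimage)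
  moreover have "inj_on F U" using ex1 unfolding U_def inj_on_def by blast
  moreover have "F holomorphic_on U" using F by (rule holomorphic_on_subset) (auto simp: U_def)
  ultimately obtain H where H: "H holomorphic_on F ` U" "\<And>z. z \<in> U \<Longrightarrow> H (F z) = z"
    using holomorphic_has_inverse by metis
  have onto: "F ` U = ball 0 \<rho>" using ex1 unfolding U_def by blast
  have inv: "H w \<in> ball 0 s \<and> F (H w) = w" if "w \<in> ball 0 \<rho>" for w
  proof -
    from that onto obtain z where "z \<in> U" "w = F z" by blast
    with H(2) show ?thesis by (simp add: U_def)
  qed
  show ?thesis by (rule that[OF H(1)[unfolded onto] inv])
qed

section \<open>The extremal radius\<close>

text \<open>
  With \<open>A = r * Re q\<close> this is what Harnack's inequality leaves of \<open>|z + r f z|\<close> on the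
  circle \<open>|z| = s\<close>.
\<close>

definition radial_bound :: "real \<Rightarrow> real \<Rightarrow> real"
  where "radial_bound A s = s * (1 + A * (1 - s) / (1 + s))"

text \<open>
  The zero of the derivative \<open>1 - A + 2 * A / (1 + s)\<^sup>2\<close> of \<open>radial_bound A\<close>, hence the place
  of its maximum. It lies inside the unit interval exactly because \<open>A > 2\<close>.
\<close>

definition critical_radius :: "real \<Rightarrow> real"
  where "critical_radius A = sqrt (2 * A / (A - 1)) - 1"

text \<open>
  Past the critical radius the bound decreases to its limit 1 at \<open>s = 1\<close>, so it still exceeds 1;
  algebraically, \<open>radial_bound A s - 1\<close> has the sign of \<open>A * s - (1 + s)\<close>.
\<close>

lemma radial_bound_at_critical_radius:
  fixes A :: real
  assumes A: "2 < A"
  shows critical_radius_pos: "0 < critical_radius A"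
    and critical_radius_less_1: "critical_radius A < 1"
    and radial_bound_critical_radius:
      "radial_bound A (critical_radius A) = (sqrt (2 * A) - sqrt (A - 1))\<^sup>2"
    and radial_bound_gt_1: "\<And>s. critical_radius A \<le> s \<Longrightarrow> s < 1 \<Longrightarrow> 1 < radial_bound A s"
proof -
  define c where "c = sqrt (2 * A / (A - 1))"
  have c2: "c\<^sup>2 = 2 * A / (A - 1)" using A by (simp add: c_def)
  have c0: "0 \<le> c" using A by (simp add: c_def)
  have "1\<^sup>2 < c\<^sup>2" "c\<^sup>2 < 2\<^sup>2" using A unfolding c2 by (auto simp: field_simps)
  then have c: "1 < c" "c < 2"
    using c0 power_less_imp_less_base[of 1 2 c] power_less_imp_less_base[of c 2 2] by auto
  then show "0 < critical_radius A" "critical_radius A < 1"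
    by (simp_all add: critical_radius_def c_def)
  have s0: "critical_radius A = c - 1" by (simp add: critical_radius_def c_def)
  show "radial_bound A (critical_radius A) = (sqrt (2 * A) - sqrt (A - 1))\<^sup>2"
  proof -
    have q: "sqrt (2 * A) = c * sqrt (A - 1)" using A by (simp add: c_def real_sqrt_divide)
    have "(sqrt (2 * A) - sqrt (A - 1))\<^sup>2 = (c - 1)\<^sup>2 * (A - 1)"
    proof -
      have "c * sqrt (A - 1) - sqrt (A - 1) = (c - 1) * sqrt (A - 1)" by (simp add: algebra_simps)
      then show ?thesis unfolding q using A by (simp add: power_mult_distrib)
    qed
    moreover have "radial_bound A (critical_radius A) = (c - 1) * ((c + A * (2 - c)) / c)"
      using c by (simp add: radial_bound_def s0 field_simps)
    moreover have "(c + A * (2 - c)) = (c - 1) * (A - 1) * c"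
    proof -
      have "c\<^sup>2 * (A - 1) = 2 * A" using A by (simp add: c2)
      then show ?thesis by (simp add: algebra_simps power2_eq_square)
    qed
    ultimately show ?thesis using c by (simp add: power2_eq_square)
  qed
  show "1 < radial_bound A s" if s: "critical_radius A \<le> s" "s < 1" for s
  proof -
    have "(A / (A - 1))\<^sup>2 < c\<^sup>2"
      unfolding c2 using A by (simp add: divide_simps power2_eq_square)
    then have "A / (A - 1) < c" using c0 by (rule power2_less_imp_less)
    then have "1 < (A - 1) * (c - 1)" using A by (simp add: field_simps)
    also have "\<dots> \<le> (A - 1) * s" using A s s0 by (intro mult_left_mono) auto
    finally have "1 + s < A * s" by (simp add: algebra_simps)
    then have "0 < (1 - s) * (A * s - (1 + s)) / (1 + s)" using s c s0 by auto
    also have "\<dots> = radial_bound A s - 1" using s c s0 by (simp add: radial_bound_def field_simps)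
    finally show ?thesis by simp
  qed
qed

section \<open>Extension of the resolvent\<close>

theorem theorem1p1:
  fixes f :: "complex \<Rightarrow> complex" and q :: complex and r :: real
  assumes "generator f"
    and "f 0 = 0"
    and "q = deriv f 0"
    and "Re q > 0"
    and "r > 2 / Re q"
  shows "let \<rho> = (sqrt (2 * r * Re q) - sqrt (r * Re q - 1))\<^sup>2 in
    \<rho> > 1 \<and>
    (\<exists>F. F holomorphic_on ball 0 \<rho> \<and>
      (\<forall>z\<in>\<bbbD>. F z = nonlinear_resolvent f r z) \<and>
      (\<forall>z\<in>ball 0 \<rho>. norm (F z) \<le> sqrt (2 * r * Re q / (r * Re q - 1)) - 1))"
proof -
  define A where "A = r * Re q"
  define \<rho> where "\<rho> = (sqrt (2 * A) - sqrt (A - 1))\<^sup>2"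
  define s0 where "s0 = critical_radius A"
  have A: "2 < A" using assms(4,5) by (simp add: A_def field_simps)
  have r: "0 < r" using assms(4,5) by (smt (verit) divide_pos_pos)
  note s0 = critical_radius_pos[OF A, folded s0_def] critical_radius_less_1[OF A, folded s0_def]
  have bound_s0: "radial_bound A s0 = \<rho>"
    using radial_bound_critical_radius[OF A] by (simp add: \<rho>_def s0_def)
  note bound_gt_1 = radial_bound_gt_1[OF A, folded s0_def]
  have f: "f holomorphic_on \<bbbD>" using assms(1) by (simp add: generator_def)
  obtain p where p: "p holomorphic_on \<bbbD>" "\<And>z. f z = z * p z" "p 0 = q"
    using div_by_id_holomorphic[OF f open_ball assms(2)] assms(3) by blast
  have Re_p_nonneg: "0 \<le> Re (p z)" if "z \<in> \<bbbD>" for z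
  proof (cases "z = 0")
    case False
    have "0 \<le> z \<bullet> f z" using generator_fixing_0_accretive[OF assms(1,2) that] .
    also have "z \<bullet> f z = (norm z)\<^sup>2 * Re (p z)"
      unfolding p(2) cmod_power2 by (simp add: inner_complex_def power2_eq_square algebra_simps)
    finally show ?thesis using False by (simp add: zero_le_mult_iff)
  qed (use p assms(4) in simp)
  define F where "F z = z + of_real r * f z" for z
  have F: "F holomorphic_on \<bbbD>" unfolding F_def by (intro holomorphic_intros f)
  \<comment> \<open>\<open>|F z| = |z| * |1 + r * p z|\<close>, and the second factor is at least its real part.\<close>
  have F_ge: "radial_bound A (norm z) \<le> norm (F z)" if "z \<in> \<bbbD>" for z
  proof -
    have "A * (1 - norm z) / (1 + norm z) = r * (Re (p 0) * (1 - norm z) / (1 + norm z))"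
      by (simp add: A_def p)
    also have "\<dots> \<le> r * Re (p z)"
      using harnack_lower_bound[OF p(1) Re_p_nonneg that] r by (intro mult_left_mono) auto
    finally have "1 + A * (1 - norm z) / (1 + norm z) \<le> Re (1 + of_real r * p z)" by simp
    also have "\<dots> \<le> norm (1 + of_real r * p z)" by (rule complex_Re_le_cmod)
    finally have "radial_bound A (norm z) \<le> norm z * norm (1 + of_real r * p z)"
      unfolding radial_bound_def by (rule mult_left_mono) simp
    then show ?thesis by (simp add: F_def p(2) norm_mult[symmetric] algebra_simps)
  qed
  have F_zero: "F z = 0 \<longleftrightarrow> z = 0" if "z \<in> \<bbbD>" for z
  proof -
    have "Re (1 + of_real r * p z) > 0" using Re_p_nonneg[OF that] r by (simp add: add_pos_nonneg)
    then have "1 + of_real r * p z \<noteq> 0" by (metis less_irrefl zero_complex.sel(1))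
    moreover have "F z = z * (1 + of_real r * p z)" by (simp add: F_def p(2) algebra_simps)
    ultimately show ?thesis by simp
  qed
  have "(F has_field_derivative 1 + of_real r * q) (at 0)"
    unfolding F_def assms(3) using holomorphic_derivI[OF f open_ball, of 0]
    by (auto intro!: derivative_eq_intros)
  then have "deriv F 0 = 1 + of_real r * q" by (rule DERIV_imp_deriv)
  moreover have "Re (1 + of_real r * q) > 0" using r assms(4) by (simp add: add_pos_pos)
  ultimately have dF: "deriv F 0 \<noteq> 0" by (metis less_irrefl zero_complex.sel(1))
  have ex1: "\<exists>!z. z \<in> ball 0 s0 \<and> F z = w" if "w \<in> ball 0 \<rho>" for w
  proof (rule unique_preimage_in_ball[OF F s0 F_zero dF])
    fix z :: complex assume "norm z = s0"
    then show "norm w < norm (F z)" using F_ge[of z] s0 that bound_s0 by simp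
  qed
  have "F holomorphic_on ball 0 s0" using F s0 by (auto intro: holomorphic_on_subset)
  from holomorphic_inverse_on_ball[OF this ex1]
  obtain G where G: "G holomorphic_on ball 0 \<rho>"
    "\<And>w. w \<in> ball 0 \<rho> \<Longrightarrow> G w \<in> ball 0 s0 \<and> F (G w) = w" by blast
  have \<rho>: "1 < \<rho>" using bound_gt_1[of s0] s0 bound_s0 by simp
  have "G w = nonlinear_resolvent f r w" if w: "w \<in> \<bbbD>" for w
  proof -
    have w\<rho>: "w \<in> ball 0 \<rho>" using w \<rho> by simp
    \<comment> \<open>The resolvent asks for uniqueness in the whole unit disk: outside the ball of radius \<open>s0\<close> the
      radial bound exceeds 1, so \<open>F\<close> takes no value in the unit disk there.\<close>
    have "z = G w" if "z \<in> \<bbbD>" "F z = w" for z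
    proof -
      have "norm z < s0"
        using bound_gt_1[of "norm z"] F_ge[OF that(1)] that w by (force simp: not_less[symmetric])
      then show ?thesis using ex1[OF w\<rho>] G(2)[OF w\<rho>] that(2) by auto
    qed
    then have "(THE z. z \<in> \<bbbD> \<and> F z = w) = G w"
      using G(2)[OF w\<rho>] s0 by (intro the_equality) auto
    then show ?thesis by (simp add: nonlinear_resolvent_def F_def)
  qed
  moreover have "norm (G w) \<le> s0" if "w \<in> ball 0 \<rho>" for w
    using G(2)[OF that] by auto
  ultimately show ?thesis
    using G(1) \<rho> unfolding Let_def \<rho>_def s0_def critical_radius_def A_def mult.assoc by blast
qed

end
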